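(* Let $U$ be a unicyclic graph of order $n\geq 3$. Then $\rho(U^{2})\leq n-1$, with equality if and only if $\mathrm{diam}(U) \le 2$.
   Context: All graphs are simple, undirected and finite. A unicyclic graph is a connected graph containing exactly one cycle. $\rho(G)$ is the spectral radius of the adjacency matrix of $G$. The square $G^2$ of a connected graph $G$ is obtained from $G$ by adding an edge between every pair of vertices at distance $2$ in $G$. $\mathrm{diam}(U)$ is the maximum distance between two vertices of $U$. *)

theory Defs
  imports
    "Graph_Theory.Graph_Theory"
    "Jordan_Normal_Form.Spectral_Radius"
begin

text \<open>
  A finite simple undirected graph is a \<^locale>\<open>pair_graph\<close>: a finite symmetric irreflexive arc
  relation, in which the undirected edge between \<open>u\<close> and \<open>v\<close> is the pair of arcs \<open>(u, v)\<close>, \<open>(v, u)\<close>.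
\<close>

definition graph_dist :: "'a pair_pre_digraph \<Rightarrow> 'a \<Rightarrow> 'a \<Rightarrow> ereal" where
  "graph_dist G u v = wf_digraph.\<mu> (with_proj G) (\<lambda>_. 1) u v"

definition graph_diam :: "'a pair_pre_digraph \<Rightarrow> ereal" where
  "graph_diam G = Max ((\<lambda>(u, v). graph_dist G u v) ` (pverts G \<times> pverts G))"

definition graph_square :: "'a pair_pre_digraph \<Rightarrow> 'a pair_pre_digraph" where
  "graph_square G =
     \<lparr> pverts = pverts G,
       parcs = parcs G \<union> {(u, v). u \<in> pverts G \<and> v \<in> pverts G \<and> graph_dist G u v = 2} \<rparr>"

text \<open>
  A closed arc walk \<open>p\<close> with \<open>pre_digraph.cycle G p\<close> carries a start vertex and an orientation, and
  going back and forth along one edge counts as a cycle of length two. An undirected cycle is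
  therefore taken to be the set of undirected edges of such a walk of length at least three.
\<close>

definition cycle_edge_sets :: "'a pair_pre_digraph \<Rightarrow> 'a set set set" where
  "cycle_edge_sets G =
     {(\<lambda>(u, v). {u, v}) ` set p | p. pre_digraph.cycle (with_proj G) p \<and> 3 \<le> length p}"

definition unicyclic :: "'a pair_pre_digraph \<Rightarrow> bool" where
  "unicyclic G \<longleftrightarrow>
     Digraph_Component.connected (with_proj G) \<and> (\<exists>!C. C \<in> cycle_edge_sets G)"

definition adjacency_matrix :: "'a pair_pre_digraph \<Rightarrow> 'a list \<Rightarrow> complex mat" where
  "adjacency_matrix G vs =
     mat (length vs) (length vs) (\<lambda>(i, j). if (vs ! i, vs ! j) \<in> parcs G then 1 else 0)"

text \<open>
  The choice of the vertex enumeration is immaterial, see \<open>graph_spectral_radius_eq\<close> below.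
\<close>

definition graph_spectral_radius :: "'a pair_pre_digraph \<Rightarrow> real" where
  "graph_spectral_radius G =
     spectral_radius (adjacency_matrix G (SOME vs. distinct vs \<and> set vs = pverts G))"

lemma adjacency_matrix_mult_vec:
  assumes "distinct vs" and "i < length vs"
  shows "(adjacency_matrix G vs *\<^sub>v vec (length vs) (\<lambda>j. f (vs ! j))) $ i =
         (\<Sum>v\<in>set vs. if (vs ! i, v) \<in> parcs G then f v else 0)"
proof -
  have "(adjacency_matrix G vs *\<^sub>v vec (length vs) (\<lambda>j. f (vs ! j))) $ i =
        (\<Sum>j\<in>{..<length vs}. if (vs ! i, vs ! j) \<in> parcs G then f (vs ! j) else 0)"
    using assms(2)
    by (auto simp: adjacency_matrix_def scalar_prod_def atLeast0LessThan intro!: sum.cong)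
  also have "\<dots> = (\<Sum>v\<in>set vs. if (vs ! i, v) \<in> parcs G then f v else 0)"
    by (rule sum.reindex_bij_betw[OF bij_betw_nth[OF assms(1) refl refl]])
  finally show ?thesis .
qed

lemma eigenvalue_adjacency_matrix_iff:
  assumes "distinct vs"
  shows "eigenvalue (adjacency_matrix G vs) k \<longleftrightarrow>
    (\<exists>f. (\<exists>v\<in>set vs. f v \<noteq> 0) \<and>
         (\<forall>u\<in>set vs. (\<Sum>v\<in>set vs. if (u, v) \<in> parcs G then f v else 0) = k * f u))"
    (is "?L \<longleftrightarrow> (\<exists>f. ?R f)")
proof -
  let ?n = "length vs"
  let ?A = "adjacency_matrix G vs"
  let ?w = "\<lambda>f. vec ?n (\<lambda>j. f (vs ! j))"
  have dim: "dim_row ?A = ?n" by (simp add: adjacency_matrix_def)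
  have key: "eigenvector ?A (?w f) k \<longleftrightarrow> ?R f" for f
  proof -
    have "?w f \<noteq> 0\<^sub>v ?n \<longleftrightarrow> (\<exists>v\<in>set vs. f v \<noteq> 0)"
      by (simp add: vec_eq_iff set_conv_nth) blast
    moreover have "?A *\<^sub>v ?w f = k \<cdot>\<^sub>v ?w f \<longleftrightarrow> (\<forall>i<?n. (?A *\<^sub>v ?w f) $ i = k * f (vs ! i))"
      using dim by (auto simp: vec_eq_iff simp del: index_mult_mat_vec)
    moreover have "\<dots> \<longleftrightarrow>
        (\<forall>u\<in>set vs. (\<Sum>v\<in>set vs. if (u, v) \<in> parcs G then f v else 0) = k * f u)"
      by (simp add: adjacency_matrix_mult_vec[OF assms] all_set_conv_all_nth
               del: index_mult_mat_vec)
    ultimately show ?thesis by (simp add: eigenvector_def dim)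
  qed
  have ex: "\<exists>f. w = ?w f" if "w \<in> carrier_vec ?n" for w :: "complex vec"
  proof
    show "w = ?w (\<lambda>v. w $ the_inv_into {..<?n} ((!) vs) v)"
      using that assms
      by (auto simp: vec_eq_iff the_inv_into_f_f inj_on_nth)
  qed
  show ?thesis
  proof
    assume ?L
    then obtain w where w: "eigenvector ?A w k" unfolding eigenvalue_def ..
    then have "w \<in> carrier_vec ?n" by (simp add: eigenvector_def dim)
    from ex[OF this] obtain f where "w = ?w f" ..
    with w have "eigenvector ?A (?w f) k" by (simp only:)
    then have "?R f" by (rule iffD1[OF key])
    then show "\<exists>f. ?R f" by (intro exI[where x = f])
  next
    assume "\<exists>f. ?R f"
    then obtain f where "?R f" by (rule exE)
    then have "eigenvector ?A (?w f) k" by (rule iffD2[OF key])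
    then show ?L unfolding eigenvalue_def by (rule exI)
  qed
qed

lemma graph_spectral_radius_eq:
  assumes "distinct vs" and "set vs = pverts G"
  shows "graph_spectral_radius G = spectral_radius (adjacency_matrix G vs)"
proof -
  define ws where "ws = (SOME vs. distinct vs \<and> set vs = pverts G)"
  have "distinct ws \<and> set ws = pverts G"
    unfolding ws_def by (rule someI[of _ vs]) (use assms in simp)
  then have ws: "distinct ws" "set ws = pverts G" by simp_all
  have "eigenvalue (adjacency_matrix G ws) k \<longleftrightarrow> eigenvalue (adjacency_matrix G vs) k" for k
    unfolding eigenvalue_adjacency_matrix_iff[OF ws(1)] eigenvalue_adjacency_matrix_iff[OF assms(1)]
      ws(2) assms(2) ..
  then have "spectrum (adjacency_matrix G ws) = spectrum (adjacency_matrix G vs)"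
    unfolding spectrum_def by (intro Collect_cong)
  then show ?thesis
    by (simp add: graph_spectral_radius_def ws_def[symmetric] spectral_radius_def)
qed

end

theory Submission
  imports Defs
begin

text \<open>
  Look at an eigenvector \<open>f\<close> of a loopless graph at a vertex \<open>u\<close> where \<open>norm (f u)\<close> is largest: the
  eigenvalue equation bounds the eigenvalue by the degree of \<open>u\<close>. If it has modulus \<open>n - 1\<close>, then
  \<open>u\<close> is adjacent to all other vertices and \<open>norm (f v)\<close> is the same at all of them, so every vertex
  is a maximum and the graph is complete. The square of a graph is complete iff the diameter of the
  graph is at most \<open>2\<close>.
\<close>

lemma eigenfunction_at_maximum:
  fixes f :: "'a \<Rightarrow> complex"
  assumes fin: "finite V" and u: "u \<in> V" and loopfree: "(u, u) \<notin> E"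
    and max: "\<And>v. v \<in> V \<Longrightarrow> norm (f v) \<le> norm (f u)" and nz: "f u \<noteq> 0"
    and eig: "(\<Sum>v\<in>V. if (u, v) \<in> E then f v else 0) = k * f u"
  shows "norm k \<le> real (card V) - 1"
    and "norm k = real (card V) - 1 \<Longrightarrow> v \<in> V \<Longrightarrow> u \<noteq> v \<Longrightarrow> (u, v) \<in> E \<and> norm (f v) = norm (f u)"
proof -
  let ?g = "\<lambda>v. if (u, v) \<in> E then norm (f v) else 0"
  have card: "real (card (V - {u})) = real (card V) - 1"
    using card_Suc_Diff1[OF fin u] by linarith
  have "norm k * norm (f u) = norm (\<Sum>v\<in>V. if (u, v) \<in> E then f v else 0)"
    by (simp add: eig norm_mult)
  also have "\<dots> \<le> (\<Sum>v\<in>V. norm (if (u, v) \<in> E then f v else 0))"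
    by (rule norm_sum)
  also have "\<dots> = sum ?g V"
    by (intro sum.cong) auto
  \<comment> \<open>The summand at \<open>u\<close> vanishes because there is no loop; this is where
    \<open>card V - 1\<close> comes from instead of \<open>card V\<close>.\<close>
  also have "\<dots> = sum ?g (V - {u})"
    using fin u loopfree by (simp add: sum.remove)
  finally have lower: "norm k * norm (f u) \<le> sum ?g (V - {u})" .
  have le: "?g v \<le> norm (f u)" if "v \<in> V - {u}" for v
    using max that by auto
  have upper: "sum ?g (V - {u}) \<le> (real (card V) - 1) * norm (f u)"
    using sum_bounded_above[of "V - {u}" ?g, OF le] unfolding card .
  from lower upper nz show "norm k \<le> real (card V) - 1"
    by (meson mult_right_le_imp_le order_trans zero_less_norm_iff)
  assume eq: "norm k = real (card V) - 1" and v: "v \<in> V" "u \<noteq> v"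
  \<comment> \<open>The lower and upper bounds now coincide, so no summand may fall short of
    \<open>norm (f u)\<close>.\<close>
  have "sum ?g (V - {u}) = (\<Sum>v\<in>V - {u}. norm (f u))"
    using lower upper eq card by simp
  then have "(\<Sum>v\<in>V - {u}. norm (f u) - ?g v) = 0"
    by (simp only: sum_subtractf)
  then have "norm (f u) - ?g v = 0"
    using fin v le by (subst (asm) sum_nonneg_eq_0_iff) auto
  \<comment> \<open>A missing arc would make \<open>?g v\<close> zero, but it equals
    \<open>norm (f u)\<close>, which is positive.\<close>
  with nz show "(u, v) \<in> E \<and> norm (f v) = norm (f u)"
    by (auto split: if_splits)
qed

text \<open>Maximality of the modulus spreads: in the equality case one maximal vertex makes all
  others maximal, and then each \<open>u\<close> can take over the role of the maximal
  vertex.\<close>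

lemma eigenvalue_loopfree:
  assumes vs: "distinct vs" and loopfree: "\<And>v. (v, v) \<notin> parcs G"
    and eig: "eigenvalue (adjacency_matrix G vs) k"
  shows "norm k \<le> real (length vs) - 1"
    and "norm k = real (length vs) - 1 \<Longrightarrow> u \<in> set vs \<Longrightarrow> v \<in> set vs \<Longrightarrow> u \<noteq> v \<Longrightarrow> (u, v) \<in> parcs G"
proof -
  obtain f w where w: "w \<in> set vs" "f w \<noteq> 0"
    and f: "\<And>u. u \<in> set vs \<Longrightarrow> (\<Sum>v\<in>set vs. if (u, v) \<in> parcs G then f v else 0) = k * f u"
    using eig unfolding eigenvalue_adjacency_matrix_iff[OF vs] by blast
  let ?M = "Max ((\<lambda>v. norm (f v)) ` set vs)"
  have M: "norm (f v) \<le> ?M" if "v \<in> set vs" for v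
    using that by simp
  have "?M \<in> (\<lambda>v. norm (f v)) ` set vs"
    using w(1) by (intro Max_in) auto
  then obtain x where x: "x \<in> set vs" "norm (f x) = ?M"
    by auto
  have pos: "?M > 0"
    using M[OF w(1)] w(2) by (meson less_le_trans zero_less_norm_iff)
  note card = distinct_card[OF vs]
  \<comment> \<open>The vertex \<open>y\<close> is kept general because the second fact is used
    twice, first at \<open>x\<close> and then at \<open>u\<close>.\<close>
  have max: "norm k \<le> real (length vs) - 1"
      "norm k = real (length vs) - 1 \<Longrightarrow> v \<in> set vs \<Longrightarrow> y \<noteq> v \<Longrightarrow> (y, v) \<in> parcs G \<and> norm (f v) = ?M"
    if y: "y \<in> set vs" "norm (f y) = ?M" for y v
  proof -
    have nz: "f y \<noteq> 0"
      using y pos by auto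
    have le: "norm (f v) \<le> norm (f y)" if "v \<in> set vs" for v
      using M[OF that] y by simp
    note * = eigenfunction_at_maximum[OF finite_set y(1) loopfree le nz f[OF y(1)], unfolded card y(2)]
    show "norm k \<le> real (length vs) - 1"
      by (rule *(1))
    show "(y, v) \<in> parcs G \<and> norm (f v) = ?M"
      if "norm k = real (length vs) - 1" "v \<in> set vs" "y \<noteq> v"
      using *(2)[OF _ that] by blast
  qed
  show "norm k \<le> real (length vs) - 1"
    by (rule max(1)[OF x])
  show "(u, v) \<in> parcs G" if "norm k = real (length vs) - 1" "u \<in> set vs" "v \<in> set vs" "u \<noteq> v"
  proof -
    have "norm (f u) = ?M"
      using max(2)[OF x that(1,2)] x(2) by (cases "x = u") auto
    from max(2)[OF that(2) this that(1,3,4)] show ?thesis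
      by simp
  qed
qed

text \<open>The spectral radius is the modulus of some eigenvalue, so the eigenvalue bounds carry
  over and give one direction of the equivalence. Conversely, a complete graph has an explicit
  eigenvalue that reaches the bound.\<close>

lemma graph_spectral_radius_loopfree:
  assumes fin: "finite (pverts G)" and ne: "pverts G \<noteq> {}" and loopfree: "\<And>v. (v, v) \<notin> parcs G"
  shows "graph_spectral_radius G \<le> real (card (pverts G)) - 1"
    and "graph_spectral_radius G = real (card (pverts G)) - 1 \<longleftrightarrow>
      (\<forall>u\<in>pverts G. \<forall>v\<in>pverts G. u \<noteq> v \<longrightarrow> (u, v) \<in> parcs G)"
proof -
  obtain vs where vs: "distinct vs" "set vs = pverts G"
    using finite_distinct_list[OF fin] by blast
  let ?A = "adjacency_matrix G vs"
  have A: "?A \<in> carrier_mat (length vs) (length vs)"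
    by (simp add: adjacency_matrix_def)
  have pos: "length vs \<noteq> 0"
    using ne vs by auto
  have card: "card (pverts G) = length vs"
    using distinct_card[OF vs(1)] vs(2) by simp
  note rho = graph_spectral_radius_eq[OF vs]
  \<comment> \<open>The matrix has positive dimension, so its spectrum is nonempty and the maximum
    is attained.\<close>
  obtain k where k: "eigenvalue ?A k" "graph_spectral_radius G = norm k"
    using spectral_radius_mem_max(1)[OF A] pos unfolding rho spectrum_def by auto
  note bounds = eigenvalue_loopfree[OF vs(1) loopfree k(1), folded k(2) card, unfolded vs(2)]
  show le: "graph_spectral_radius G \<le> real (card (pverts G)) - 1"
    by (rule bounds(1))
  show "graph_spectral_radius G = real (card (pverts G)) - 1 \<longleftrightarrow>
      (\<forall>u\<in>pverts G. \<forall>v\<in>pverts G. u \<noteq> v \<longrightarrow> (u, v) \<in> parcs G)" (is "_ \<longleftrightarrow> ?complete")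
  proof
    assume complete: ?complete
    \<comment> \<open>This eigenvalue belongs to the constant function 1. The subtraction on
      naturals is exact since there is at least one vertex.\<close>
    let ?k = "of_nat (card (pverts G) - 1) :: complex"
    have "(\<Sum>v\<in>pverts G. if (u, v) \<in> parcs G then 1 else 0) = ?k" if u: "u \<in> pverts G" for u
    proof -
      have "(\<Sum>v\<in>pverts G. if (u, v) \<in> parcs G then 1 else 0 :: complex) = (\<Sum>v\<in>pverts G - {u}. 1)"
        using fin complete loopfree u by (intro sum.mono_neutral_cong_right) auto
      then show ?thesis
        using u by (simp add: card_Diff_singleton)
    qed
    then have "eigenvalue ?A ?k"
      unfolding eigenvalue_adjacency_matrix_iff[OF vs(1)] vs(2) using ne
      by (intro exI[of _ "\<lambda>_. 1"]) auto
    then have "norm ?k \<le> graph_spectral_radius G"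
      unfolding rho using pos by (intro spectral_radius_mem_max(2)[OF A] imageI) (simp_all add: spectrum_def)
    moreover have "norm ?k = real (card (pverts G)) - 1"
      unfolding norm_of_nat using pos card by linarith
    ultimately show "graph_spectral_radius G = real (card (pverts G)) - 1"
      using le by simp
  qed (use bounds(2) in blast)
qed

lemma (in wf_digraph) awalk_cost_one: "awalk_cost (\<lambda>_. 1) p = real (length p)"
  by (induct p) auto

lemma (in pair_fin_digraph) graph_dist_le_length:
  assumes "awalk u p v"
  shows "graph_dist G u v \<le> real (length p)"
  using min_cost_le_walk_cost[OF assms, of "\<lambda>_. 1"] by (simp add: graph_dist_def awalk_cost_one)

text \<open>A finite distance means reachability, and since the unit costs are nonnegative the
  infimum over walks is reached by a path.\<close>

lemma (in pair_fin_digraph) graph_dist_attained: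
  assumes "graph_dist G u v < \<infinity>"
  obtains p where "awalk u p v" and "graph_dist G u v = real (length p)"
proof -
  have "u \<rightarrow>\<^sup>*\<^bsub>with_proj G\<^esub> v"
    using assms unfolding graph_dist_def \<mu>_reach_conv .
  from min_cost_awalk[OF this, of "\<lambda>_. 1"] obtain p
    where "apath u p v" "graph_dist G u v = real (length p)"
    unfolding graph_dist_def awalk_cost_one using zero_le_one by blast
  then show ?thesis
    by (intro that awalkI_apath)
qed

lemma (in pair_fin_digraph) graph_dist_self:
  assumes "u \<in> pverts G"
  shows "graph_dist G u u \<le> 0"
  using graph_dist_le_length[of u "[]" u] assms by (simp add: awalk_Nil_iff zero_ereal_def)

text \<open>A shortest walk between distinct vertices at distance at most 2 has length 1, giving an
  original arc, or length 2, giving an arc added by the square.\<close>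

lemma (in pair_fin_digraph) graph_dist_le_2_iff:
  assumes "u \<in> pverts G" "v \<in> pverts G" "u \<noteq> v"
  shows "graph_dist G u v \<le> 2 \<longleftrightarrow> (u, v) \<in> parcs (graph_square G)"
proof
  assume le: "graph_dist G u v \<le> 2"
  then have "graph_dist G u v < \<infinity>"
    by auto
  then obtain p where p: "awalk u p v" "graph_dist G u v = real (length p)"
    by (rule graph_dist_attained)
  have "ereal (real (length p)) \<le> ereal 2"
    using le p(2) by simp
  then have "length p \<le> 2"
    by simp
  moreover have "length p \<noteq> 0"
    using p(1) assms(3) by (auto simp: awalk_Nil_iff)
  ultimately have "length p = 1 \<or> length p = 2"
    by linarith
  moreover have "(u, v) \<in> parcs G" if "length p = 1"
    using that p(1) by (auto simp: length_Suc_conv awalk_Cons_iff awalk_Nil_iff)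
  ultimately have "(u, v) \<in> parcs G \<or> length p = 2"
    by blast
  with p(2) assms show "(u, v) \<in> parcs (graph_square G)"
    by (auto simp: graph_square_def)
next
  assume "(u, v) \<in> parcs (graph_square G)"
  then consider "(u, v) \<in> parcs G" | "graph_dist G u v = 2"
    by (auto simp: graph_square_def)
  then show "graph_dist G u v \<le> 2"
  proof cases
    case 1
    then have "awalk u [(u, v)] v"
      using assms by (simp add: awalk_Cons_iff awalk_Nil_iff)
    from graph_dist_le_length[OF this] have "graph_dist G u v \<le> 1"
      by (simp add: one_ereal_def)
    also have "(1 :: ereal) \<le> 2"
      by simp
    finally show ?thesis .
  qed simp
qed

text \<open>The maximum also ranges over diagonal pairs, but these never exceed 2 because of the
  empty walk, so only distinct vertices matter.\<close>

lemma (in pair_fin_digraph) graph_diam_le_2_iff: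
  assumes "pverts G \<noteq> {}"
  shows "graph_diam G \<le> 2 \<longleftrightarrow>
    (\<forall>u\<in>pverts G. \<forall>v\<in>pverts G. u \<noteq> v \<longrightarrow> (u, v) \<in> parcs (graph_square G))"
proof -
  have "graph_diam G \<le> 2 \<longleftrightarrow> (\<forall>u\<in>pverts G. \<forall>v\<in>pverts G. graph_dist G u v \<le> 2)"
    unfolding graph_diam_def using assms by (subst Max_le_iff) auto
  also have "\<dots> \<longleftrightarrow>
      (\<forall>u\<in>pverts G. \<forall>v\<in>pverts G. u \<noteq> v \<longrightarrow> (u, v) \<in> parcs (graph_square G))"
  proof (intro ball_cong refl)
    fix u v assume uv: "u \<in> pverts G" "v \<in> pverts G"
    show "graph_dist G u v \<le> 2 \<longleftrightarrow> (u \<noteq> v \<longrightarrow> (u, v) \<in> parcs (graph_square G))"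
    proof (cases "u = v")
      case True
      have "graph_dist G u u \<le> 2"
        using graph_dist_self[OF uv(1)] by (rule order_trans) simp
      with True show ?thesis
        by simp
    next
      case False
      with graph_dist_le_2_iff[OF uv False] show ?thesis
        by simp
    qed
  qed
  finally show ?thesis .
qed

text \<open>A loop could only be an added arc, which requires distance 2, whereas a vertex is at
  distance at most 0 from itself.\<close>

lemma (in pair_digraph) graph_square_loopfree: "(v, v) \<notin> parcs (graph_square G)"
proof
  assume "(v, v) \<in> parcs (graph_square G)"
  then have "v \<in> pverts G" "graph_dist G v v = 2"
    using no_loops[of "(v, v)"] by (auto simp: graph_square_def)
  with graph_dist_self[of v] show False
    by simp
qed

theorem theorem4p1:
  fixes U :: "'a pair_pre_digraph" and n :: nat
  assumes "pair_graph U" and "unicyclic U"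
    and "card (pverts U) = n" and "n \<ge> 3"
  shows "graph_spectral_radius (graph_square U) \<le> real n - 1 \<and>
    (graph_spectral_radius (graph_square U) = real n - 1 \<longleftrightarrow> graph_diam U \<le> 2)"
proof -
  interpret pair_graph U by fact
  have verts: "pverts (graph_square U) = pverts U"
    by (simp add: graph_square_def)
  have ne: "pverts U \<noteq> {}"
    using assms(3,4) by auto
  show ?thesis
    \<comment> \<open>The spectral bound is applied to the square, which has the same
      \<open>n\<close> vertices; its completeness is then traded for the diameter condition on
      \<open>U\<close>.\<close>
    using graph_spectral_radius_loopfree[of "graph_square U", unfolded verts assms(3),
        OF pair_finite_verts ne graph_square_loopfree]
    unfolding graph_diam_le_2_iff[OF ne] by blast
qed

end
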